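(* Let $\mathbb{E}$ be a (finite-dimensional) Euclidean space and $f\in\Gamma_0(\mathbb{E})$. Then the following hold as $\lambda\downarrow0$: (a) $e_\lambda f$ epi-converges to $f$ and $e_\lambda f$ converges pointwise to $f$ (in fact $e_\lambda f(x)\uparrow f(x)$ for all $x\in\mathbb{E}$); (b) $\lambda f$ epi-converges to $\delta_{\mathrm{cl}(\mathrm{dom} f)}$; (c) for every $\bar x\in\mathbb{E}$, $\lambda e_\lambda f(x)\to\frac12 d^2_{\mathrm{cl}(\mathrm{dom} f)}(\bar x)$ as $x\to\bar x$ (and $\lambda\downarrow0$); (d) $\lambda\,\partial f$ converges graphically to $N_{\mathrm{cl}(\mathrm{dom} f)}$; (e) for $x\in\mathrm{dom}\,\partial f$, $\nabla e_\lambda f(x)\to\mathrm{argmin}_{g\in\partial f(x)}\|g\|$.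
   Context: $\Gamma_0(\mathbb{E})$ denotes the closed proper convex functions $\mathbb{E}\to\mathbb{R}\cup\{+\infty\}$. The Moreau envelope is $e_\lambda f(x)=\min_{u\in\mathbb{E}}\{f(u)+\frac{1}{2\lambda}\|x-u\|^2\}$ for $\lambda>0$. $\delta_C$ is the indicator function of $C$, $N_C=\partial\delta_C$ the normal cone map of a closed convex set $C$, and $d_C$ the Euclidean distance to $C$. $\mathrm{dom}\,\partial f=\{x\mid\partial f(x)\neq\emptyset\}$. A sequence $f_k$ epi-converges to $f$ if for all $x$: $\liminf_k f_k(x_k)\ge f(x)$ for every $x_k\to x$, and there exists $x_k\to x$ with $\limsup_kf_k(x_k)\le f(x)$. A family $f_\lambda$ epi-converges (resp. converges pointwise) to $f$ as $\lambda\downarrow0$ if this holds for $f_{\lambda_k}$ for every sequence $\lambda_k\downarrow0$. A family of set-valued maps $S_\lambda$ converges graphically to $S$ if for every sequence $\lambda_k\downarrow0$ the graphs $\mathrm{gph}\,S_{\lambda_k}$ converge to $\mathrm{gph}\,S$ in the sense of Painlevé–Kuratowski. *)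

theory Defs
  imports "HOL-Analysis.Analysis"
begin

section \<open>Closed proper convex functions\<close>

definition effective_domain :: "('a \<Rightarrow> ereal) \<Rightarrow> 'a set" where
  "effective_domain f = {x. f x < \<infinity>}"

definition ereal_epigraph :: "('a \<Rightarrow> ereal) \<Rightarrow> ('a \<times> real) set" where
  "ereal_epigraph f = {(x, r). f x \<le> ereal r}"

text \<open>The class \<open>\<Gamma>\<^sub>0\<close>. Convexity and closedness (lower semicontinuity) are those of the epigraph,
  which avoids sums of opposite infinities.\<close>

definition closed_proper_convex :: "('a::euclidean_space \<Rightarrow> ereal) \<Rightarrow> bool" where
  "closed_proper_convex f \<longleftrightarrow>
     (\<forall>x. f x \<noteq> -\<infinity>) \<and> effective_domain f \<noteq> {} \<and>
     convex (ereal_epigraph f) \<and> closed (ereal_epigraph f)"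

definition indicator_fun :: "'a set \<Rightarrow> 'a \<Rightarrow> ereal" where
  "indicator_fun C x = (if x \<in> C then 0 else \<infinity>)"

definition subdifferential :: "('a::euclidean_space \<Rightarrow> ereal) \<Rightarrow> 'a \<Rightarrow> 'a set" where
  "subdifferential f x = {g. \<forall>y. f x + ereal (g \<bullet> (y - x)) \<le> f y}"

definition normal_cone :: "'a::euclidean_space set \<Rightarrow> 'a \<Rightarrow> 'a set" where
  "normal_cone C = subdifferential (indicator_fun C)"

definition svm_domain :: "('a \<Rightarrow> 'b set) \<Rightarrow> 'a set" where
  "svm_domain S = {x. S x \<noteq> {}}"

definition svm_graph :: "('a \<Rightarrow> 'b set) \<Rightarrow> ('a \<times> 'b) set" where
  "svm_graph S = {(x, y). y \<in> S x}"

section \<open>Moreau envelope and gradients\<close>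

text \<open>The infimum is a minimum for closed proper convex functions; see
  \<open>moreau_envelope_attained\<close> below.\<close>

definition moreau_envelope :: "real \<Rightarrow> ('a::euclidean_space \<Rightarrow> ereal) \<Rightarrow> 'a \<Rightarrow> ereal" where
  "moreau_envelope l f x = (INF u. f u + ereal (1 / (2 * l) * (norm (x - u))\<^sup>2))"

text \<open>Gradients of extended-real-valued functions exist only at points around which the function
  is finite.\<close>

definition has_gradient :: "('a::euclidean_space \<Rightarrow> ereal) \<Rightarrow> 'a \<Rightarrow> 'a \<Rightarrow> bool" where
  "has_gradient F x D \<longleftrightarrow>
     (\<forall>\<^sub>F y in nhds x. \<bar>F y\<bar> \<noteq> \<infinity>) \<and> (GDERIV (\<lambda>y. real_of_ereal (F y)) x :> D)"

definition gradient :: "('a::euclidean_space \<Rightarrow> ereal) \<Rightarrow> 'a \<Rightarrow> 'a" where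
  "gradient F x = (THE D. has_gradient F x D)"

section \<open>Modes of convergence\<close>

definition epi_converges :: "(nat \<Rightarrow> 'a::euclidean_space \<Rightarrow> ereal) \<Rightarrow> ('a \<Rightarrow> ereal) \<Rightarrow> bool" where
  "epi_converges F f \<longleftrightarrow>
     (\<forall>x. (\<forall>X. X \<longlonglongrightarrow> x \<longrightarrow> f x \<le> liminf (\<lambda>k. F k (X k))) \<and>
          (\<exists>X. X \<longlonglongrightarrow> x \<and> limsup (\<lambda>k. F k (X k)) \<le> f x))"

definition outer_limit :: "(nat \<Rightarrow> 'b::topological_space set) \<Rightarrow> 'b set" where
  "outer_limit C =
     {z. \<exists>r Z. strict_mono (r :: nat \<Rightarrow> nat) \<and> (\<forall>k. Z k \<in> C (r k)) \<and> Z \<longlonglongrightarrow> z}"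

definition inner_limit :: "(nat \<Rightarrow> 'b::topological_space set) \<Rightarrow> 'b set" where
  "inner_limit C = {z. \<exists>Z. (\<forall>\<^sub>F k in sequentially. Z k \<in> C k) \<and> Z \<longlonglongrightarrow> z}"

definition PK_converges :: "(nat \<Rightarrow> 'b::topological_space set) \<Rightarrow> 'b set \<Rightarrow> bool" where
  "PK_converges C L \<longleftrightarrow> outer_limit C = L \<and> inner_limit C = L"

text \<open>\<open>\<lambda>\<^sub>k \<down> 0\<close> means convergence to \<open>0\<close> through positive numbers; monotonicity is not required.\<close>

definition down_to_zero :: "(nat \<Rightarrow> real) \<Rightarrow> bool" where
  "down_to_zero l \<longleftrightarrow> (\<forall>k. 0 < l k) \<and> l \<longlonglongrightarrow> 0"

definition family_epi_converges ::
    "(real \<Rightarrow> 'a::euclidean_space \<Rightarrow> ereal) \<Rightarrow> ('a \<Rightarrow> ereal) \<Rightarrow> bool" where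
  "family_epi_converges F f \<longleftrightarrow> (\<forall>l. down_to_zero l \<longrightarrow> epi_converges (\<lambda>k. F (l k)) f)"

definition family_pointwise_converges ::
    "(real \<Rightarrow> 'a::euclidean_space \<Rightarrow> ereal) \<Rightarrow> ('a \<Rightarrow> ereal) \<Rightarrow> bool" where
  "family_pointwise_converges F f \<longleftrightarrow>
     (\<forall>l. down_to_zero l \<longrightarrow> (\<forall>x. (\<lambda>k. F (l k) x) \<longlonglongrightarrow> f x))"

definition family_graph_converges ::
    "(real \<Rightarrow> 'a::euclidean_space \<Rightarrow> 'a set) \<Rightarrow> ('a \<Rightarrow> 'a set) \<Rightarrow> bool" where
  "family_graph_converges S T \<longleftrightarrow>
     (\<forall>l. down_to_zero l \<longrightarrow> PK_converges (\<lambda>k. svm_graph (S (l k))) (svm_graph T))"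

section \<open>Well-definedness\<close>

lemma has_gradient_unique:
  assumes "has_gradient F x D" "has_gradient F x D'"
  shows "D = D'"
proof -
  have eq: "(\<lambda>h. h \<bullet> D) = (\<lambda>h. h \<bullet> D')"
    using assms has_derivative_unique unfolding has_gradient_def gderiv_def by blast
  have "(D - D') \<bullet> (D - D') = 0"
    using fun_cong[OF eq, of "D - D'"] by (simp add: inner_diff_right)
  then show ?thesis by simp
qed

lemma gradient_eq: "has_gradient F x D \<Longrightarrow> gradient F x = D"
  unfolding gradient_def using has_gradient_unique by blast

lemma closed_proper_convex_affine_minorant:
  fixes f :: "'a::euclidean_space \<Rightarrow> ereal"
  assumes "closed_proper_convex f"
  obtains a b where "\<And>u. ereal (a \<bullet> u + b) \<le> f u"
proof -
  have ninf: "f x \<noteq> -\<infinity>" for x using assms by (auto simp: closed_proper_convex_def)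
  obtain x0 where "f x0 < \<infinity>"
    using assms by (auto simp: closed_proper_convex_def effective_domain_def)
  then obtain r0 where r0: "f x0 = ereal r0" using ninf[of x0] by (cases "f x0") auto
  have "(x0, r0 - 1) \<notin> ereal_epigraph f" by (simp add: ereal_epigraph_def r0)
  then obtain p c where p: "p \<bullet> (x0, r0 - 1) < c" "\<forall>z\<in>ereal_epigraph f. c < p \<bullet> z"
    using separating_hyperplane_closed_point[of "ereal_epigraph f" "(x0, r0 - 1)"] assms
    by (auto simp: closed_proper_convex_def)
  obtain v q where pq: "p = (v, q)" by force
  have sep: "c < v \<bullet> u + q * r" if "f u \<le> ereal r" for u r
    using p(2) that by (auto simp: pq ereal_epigraph_def)
  have q: "q > 0" using sep[of x0 r0] p(1) by (simp add: pq r0 algebra_simps)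
  have "ereal ((- v /\<^sub>R q) \<bullet> u + c / q) \<le> f u" for u
  proof (cases "f u")
    case (real r)
    have "c < v \<bullet> u + q * r" using sep real by simp
    then show ?thesis using q real by (simp add: field_simps)
  qed (use ninf in auto)
  then show ?thesis using that by blast
qed

lemma moreau_envelope_attained:
  fixes f :: "'a::euclidean_space \<Rightarrow> ereal"
  assumes f: "closed_proper_convex f" and l: "0 < l"
  shows "\<exists>u. moreau_envelope l f x = f u + ereal (1 / (2 * l) * (norm (x - u))\<^sup>2)
             \<and> \<bar>moreau_envelope l f x\<bar> \<noteq> \<infinity>"
proof -
  have ninf: "f x \<noteq> -\<infinity>" for x using f by (auto simp: closed_proper_convex_def)
  obtain x0 where "f x0 < \<infinity>"
    using f by (auto simp: closed_proper_convex_def effective_domain_def)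
  then obtain r0 where r0: "f x0 = ereal r0" using ninf[of x0] by (cases "f x0") auto
  obtain a b where ab: "\<And>u. ereal (a \<bullet> u + b) \<le> f u"
    using closed_proper_convex_affine_minorant[OF f] by blast
  define g where "g = (\<lambda>z::'a \<times> real. snd z + 1 / (2 * l) * (norm (x - fst z))\<^sup>2)"
  define K where "K = ereal_epigraph f \<inter> {z. g z \<le> g (x0, r0)}"
  define M where "M = \<bar>g (x0, r0) - b\<bar> + norm a * norm x"
  define R where "R = 1 + 2 * l * (M + norm a)"
  have cont: "continuous_on UNIV g" unfolding g_def by (intro continuous_intros)
  have "closed {z. g z \<le> g (x0, r0)}"
    by (intro closed_Collect_le cont continuous_on_const)
  then have closedK: "closed K" using f by (auto simp: K_def closed_proper_convex_def)
  have M0: "M \<ge> 0" by (simp add: M_def)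
  have K1: "norm (x - u) \<le> R \<and> r \<le> g (x0, r0) \<and> a \<bullet> u + b \<le> r" if "(u, r) \<in> K" for u r
  proof -
    define t where "t = norm (x - u)"
    have t0: "t \<ge> 0" by (simp add: t_def)
    have fu: "f u \<le> ereal r" and gu: "r + 1 / (2 * l) * t\<^sup>2 \<le> g (x0, r0)"
      using that by (auto simp: K_def ereal_epigraph_def g_def t_def)
    have r: "a \<bullet> u + b \<le> r" using order_trans[OF ab fu] by simp
    have "norm u \<le> norm x + t" unfolding t_def using norm_triangle_sub[of u x]
      by (simp add: norm_minus_commute)
    then have "norm a * norm u \<le> norm a * (norm x + t)" by (simp add: mult_left_mono)
    moreover have "- (a \<bullet> u) \<le> norm a * norm u" using Cauchy_Schwarz_ineq2[of a u] by linarith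
    ultimately have "1 / (2 * l) * t\<^sup>2 \<le> M + norm a * t"
      using gu r by (simp add: M_def algebra_simps)
    then have sq: "t\<^sup>2 \<le> 2 * l * (M + norm a * t)" using l by (simp add: field_simps)
    have "t \<le> R"
    proof (cases "t \<le> 1")
      case True
      moreover have "0 \<le> 2 * l * (M + norm a)" using l M0 by simp
      ultimately show ?thesis by (simp add: R_def)
    next
      case False
      then have "M * 1 \<le> M * t" using M0 by (intro mult_left_mono) auto
      then have "2 * l * (M + norm a * t) \<le> 2 * l * ((M + norm a) * t)"
        using l by (intro mult_left_mono) (auto simp: algebra_simps)
      then have "t * t \<le> (2 * l * (M + norm a)) * t"
        using sq by (simp add: power2_eq_square algebra_simps)
      then have "t \<le> 2 * l * (M + norm a)" using False by simp
      then show ?thesis by (simp add: R_def)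
    qed
    moreover have "0 \<le> 1 / (2 * l) * t\<^sup>2" using l by simp
    ultimately show ?thesis using gu r by (simp add: t_def)
  qed
  have "K \<subseteq> cball x R \<times> {b - norm a * (norm x + R) .. g (x0, r0)}"
  proof
    fix z assume z: "z \<in> K"
    obtain u r where zz: "z = (u, r)" by force
    have k: "norm (x - u) \<le> R" "r \<le> g (x0, r0)" "a \<bullet> u + b \<le> r"
      using K1 z zz by auto
    have "norm u \<le> norm x + R" using k(1) norm_triangle_sub[of u x]
      by (simp add: norm_minus_commute)
    then have "norm a * norm u \<le> norm a * (norm x + R)" by (simp add: mult_left_mono)
    then show "z \<in> cball x R \<times> {b - norm a * (norm x + R) .. g (x0, r0)}"
      using k Cauchy_Schwarz_ineq2[of a u] by (auto simp: zz dist_norm)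
  qed
  then have "bounded K" by (rule bounded_subset[rotated]) (intro bounded_Times; simp)
  then have "compact K" using closedK compact_eq_bounded_closed by blast
  moreover have x0K: "(x0, r0) \<in> K" by (simp add: K_def ereal_epigraph_def r0)
  ultimately obtain z where z: "z \<in> K" "\<forall>w\<in>K. g z \<le> g w"
    using continuous_attains_inf[of K g] continuous_on_subset[OF cont] by blast
  obtain u r where zz: "z = (u, r)" by force
  have fu: "f u \<le> ereal r" using z by (auto simp: zz K_def ereal_epigraph_def)
  have minz: "ereal (g z) \<le> f v + ereal (1 / (2 * l) * (norm (x - v))\<^sup>2)" for v
  proof (cases "f v")
    case (real s)
    have "g z \<le> g (v, s)"
    proof (cases "(v, s) \<in> K")
      case True then show ?thesis using z by blast
    next
      case False
      then have "g (x0, r0) < g (v, s)" using real by (auto simp: K_def ereal_epigraph_def)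
      then show ?thesis using z(2) x0K by force
    qed
    then show ?thesis by (simp add: real g_def)
  qed (use ninf in auto)
  have le: "f u + ereal (1 / (2 * l) * (norm (x - u))\<^sup>2) \<le> ereal (g z)"
    using add_right_mono[OF fu, of "ereal (1 / (2 * l) * (norm (x - u))\<^sup>2)"]
    by (simp add: g_def zz)
  have "moreau_envelope l f x = ereal (g z)"
    unfolding moreau_envelope_def
  proof (rule antisym)
    show "(INF u. f u + ereal (1 / (2 * l) * (norm (x - u))\<^sup>2)) \<le> ereal (g z)"
      using INF_lower le by (rule order_trans) simp
    show "ereal (g z) \<le> (INF u. f u + ereal (1 / (2 * l) * (norm (x - u))\<^sup>2))"
      by (rule INF_greatest) (rule minz)
  qed
  moreover have "f u + ereal (1 / (2 * l) * (norm (x - u))\<^sup>2) = ereal (g z)"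
    using le minz[of u] by (rule antisym)
  ultimately show ?thesis by (intro exI[of _ u]) simp
qed

end

theory Submission
  imports Defs
begin

text \<open>Write \<open>C\<close> for the closure of the effective domain of \<open>f\<close>, \<open>d\<close> for the distance to \<open>C\<close>,
  \<open>\<Pi>\<close> for the projection onto \<open>C\<close>, \<open>e\<^sub>l\<close> for the Moreau envelope and \<open>p\<^sub>l\<close> for the proximal mapping,
  which selects the minimizer in the envelope. All five limits rest on two estimates for the scaled
  envelope. Testing with a fixed point \<open>u\<close> of the domain gives
  \<open>l e\<^sub>l(x) \<le> l f(u) + \<parallel>x - u\<parallel>\<^sup>2 / 2\<close>; an affine minorant \<open>a \<bullet> u + b\<close> of \<open>f\<close> gives
  \<open>l e\<^sub>l(x) \<ge> l (a \<bullet> x + b) - l \<parallel>a\<parallel>\<^sup>2 / 2 + (1 - l) \<parallel>x - p\<^sub>l(x)\<parallel>\<^sup>2 / 2\<close>. As \<open>p\<^sub>l(x)\<close> lies in \<open>C\<close>,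
  together they show that \<open>l e\<^sub>l(x)\<close> tends to \<open>d\<^sup>2 / 2\<close> and, by the obtuse angle criterion, that
  \<open>p\<^sub>l(x)\<close> tends to the projection of the limit point, jointly in \<open>x\<close> and \<open>l\<close>
  (\<open>scaled_envelope_tendsto\<close>, \<open>prox_tendsto_closest_point\<close>).

  The rest follows. Since \<open>f(p\<^sub>l(x)) \<le> e\<^sub>l(x) \<le> f(x)\<close>, lower semicontinuity gives the convergence of
  the envelopes at points of \<open>C\<close>; outside \<open>C\<close> they blow up because \<open>l e\<^sub>l\<close> has a positive limit. The
  proximal points are a recovery sequence for \<open>l f\<close>. The proximal mapping is the resolvent of the
  subdifferential and the projection that of the normal cone map, so that the graphs are
  parametrized by \<open>z \<mapsto> (p\<^sub>l(z), z - p\<^sub>l(z))\<close> and \<open>z \<mapsto> (\<Pi>(z), z - \<Pi>(z))\<close>, and graphical convergence is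
  convergence of the parametrizations. Finally the gradient of \<open>e\<^sub>l\<close> at \<open>x\<close> is \<open>(x - p\<^sub>l(x)) / l\<close>, a
  subgradient at \<open>p\<^sub>l(x)\<close>; monotonicity bounds its norm by that of every subgradient at \<open>x\<close>, and
  closedness of the graph of the subdifferential leaves the element of least norm as the only
  cluster point.\<close>

section \<open>Closed proper convex functions\<close>

lemma closed_proper_convex_not_MInf:
  "closed_proper_convex f \<Longrightarrow> f x \<noteq> -\<infinity>"
  by (auto simp: closed_proper_convex_def)

lemma effective_domain_realE:
  assumes "closed_proper_convex f" "u \<in> effective_domain f"
  obtains r where "f u = ereal r"
  using assms closed_proper_convex_not_MInf[OF assms(1), of u]
  by (cases "f u") (auto simp: effective_domain_def)

lemma closed_proper_convex_nonempty_domain: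
  "closed_proper_convex f \<Longrightarrow> effective_domain f \<noteq> {}"
  by (auto simp: closed_proper_convex_def)

lemma closed_proper_convex_convexD:
  fixes f :: "'a::euclidean_space \<Rightarrow> ereal"
  assumes f: "closed_proper_convex f" and "f u = ereal r" "f v = ereal s" "0 \<le> t" "t \<le> 1"
  shows "f ((1 - t) *\<^sub>R u + t *\<^sub>R v) \<le> ereal ((1 - t) * r + t * s)"
proof -
  have "convex (ereal_epigraph f)" using f by (auto simp: closed_proper_convex_def)
  moreover have "(u, r) \<in> ereal_epigraph f" "(v, s) \<in> ereal_epigraph f"
    using assms by (auto simp: ereal_epigraph_def)
  ultimately have "(1 - t) *\<^sub>R (u, r) + t *\<^sub>R (v, s) \<in> ereal_epigraph f"
    using assms(4,5) unfolding convex_alt by blast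
  then show ?thesis by (simp add: ereal_epigraph_def)
qed

lemma convex_effective_domain:
  fixes f :: "'a::euclidean_space \<Rightarrow> ereal"
  assumes f: "closed_proper_convex f"
  shows "convex (effective_domain f)"
  unfolding convex_alt
proof (intro ballI allI impI)
  fix u v t assume uv: "u \<in> effective_domain f" "v \<in> effective_domain f" and t: "0 \<le> t \<and> t \<le> (1::real)"
  obtain r s where "f u = ereal r" "f v = ereal s"
    using uv effective_domain_realE[OF f] by metis
  with closed_proper_convex_convexD[OF f] t
  have "f ((1 - t) *\<^sub>R u + t *\<^sub>R v) \<le> ereal ((1 - t) * r + t * s)" by blast
  also have "\<dots> < \<infinity>" by simp
  finally show "(1 - t) *\<^sub>R u + t *\<^sub>R v \<in> effective_domain f" by (simp add: effective_domain_def)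
qed

text \<open>Lower semicontinuity along an arbitrary filter.\<close>

lemma closed_proper_convex_lsc:
  fixes f :: "'a::euclidean_space \<Rightarrow> ereal"
  assumes f: "closed_proper_convex f" and X: "(X \<longlongrightarrow> x) F"
  shows "f x \<le> Liminf F (\<lambda>k. f (X k))"
  unfolding le_Liminf_iff
proof (intro allI impI)
  fix y assume "y < f x"
  then obtain z where z: "y < ereal z" "ereal z < f x" using ereal_dense2 by blast
  have "closed ((\<lambda>u. (u, z)) -` ereal_epigraph f)"
    using f by (intro closed_vimage continuous_intros) (auto simp: closed_proper_convex_def)
  then have "open (- {u. f u \<le> ereal z})" by (simp add: vimage_def ereal_epigraph_def open_closed)
  moreover have "x \<in> - {u. f u \<le> ereal z}" using z by auto
  ultimately have "\<forall>\<^sub>F k in F. X k \<in> - {u. f u \<le> ereal z}"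
    using X by (rule topological_tendstoD[rotated])
  then show "\<forall>\<^sub>F k in F. y < f (X k)"
    by eventually_elim (use z in auto)
qed

section \<open>Subdifferentials and normal cones\<close>

lemma subdifferential_finite:
  assumes f: "closed_proper_convex f" and g: "g \<in> subdifferential f x"
  shows "x \<in> effective_domain f"
proof -
  obtain y where "y \<in> effective_domain f"
    using closed_proper_convex_nonempty_domain[OF f] by blast
  moreover have "f x + ereal (g \<bullet> (y - x)) \<le> f y"
    using g by (auto simp: subdifferential_def)
  ultimately show ?thesis by (cases "f x") (auto simp: effective_domain_def)
qed

lemma subdifferential_mono:
  assumes f: "closed_proper_convex f"
    and g: "g \<in> subdifferential f x" and h: "h \<in> subdifferential f y"
  shows "0 \<le> (g - h) \<bullet> (x - y)"
proof -
  obtain r s where rs: "f x = ereal r" "f y = ereal s"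
    using effective_domain_realE[OF f] subdifferential_finite[OF f] g h by metis
  have "f x + ereal (g \<bullet> (y - x)) \<le> f y" "f y + ereal (h \<bullet> (x - y)) \<le> f x"
    using g h by (auto simp: subdifferential_def)
  then show ?thesis by (simp add: rs inner_diff_left inner_diff_right)
qed

lemma subdifferential_closed_convex:
  fixes f :: "'a::euclidean_space \<Rightarrow> ereal"
  assumes f: "closed_proper_convex f" and x: "f x = ereal r"
  shows "closed (subdifferential f x)" "convex (subdifferential f x)"
proof -
  have eq: "subdifferential f x =
      (\<Inter>y\<in>effective_domain f. {g. (y - x) \<bullet> g \<le> real_of_ereal (f y) - r})"
  proof (intro set_eqI)
    fix g
    have "f x + ereal (g \<bullet> (y - x)) \<le> f y \<longleftrightarrow>
        (y \<in> effective_domain f \<longrightarrow> (y - x) \<bullet> g \<le> real_of_ereal (f y) - r)" for y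
      using closed_proper_convex_not_MInf[OF f, of y]
      by (cases "f y") (auto simp: x effective_domain_def inner_commute)
    then show "g \<in> subdifferential f x \<longleftrightarrow>
        g \<in> (\<Inter>y\<in>effective_domain f. {g. (y - x) \<bullet> g \<le> real_of_ereal (f y) - r})"
      by (auto simp: subdifferential_def)
  qed
  show "closed (subdifferential f x)"
    unfolding eq by (intro closed_INT ballI closed_halfspace_le)
  show "convex (subdifferential f x)"
    unfolding eq by (intro convex_INT convex_halfspace_le)
qed

text \<open>The graph of the subdifferential is closed.\<close>

lemma subdifferential_closed_graph:
  fixes f :: "'a::euclidean_space \<Rightarrow> ereal"
  assumes f: "closed_proper_convex f"
    and X: "X \<longlonglongrightarrow> x" and G: "G \<longlonglongrightarrow> g"
    and mem: "\<And>k. G k \<in> subdifferential f (X k)"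
  shows "g \<in> subdifferential f x"
  unfolding subdifferential_def
proof (intro CollectI allI)
  fix y
  show "f x + ereal (g \<bullet> (y - x)) \<le> f y"
  proof (cases "f y")
    case (real s)
    define c where "c = (\<lambda>k. s - G k \<bullet> (y - X k))"
    have "f (X k) \<le> ereal (c k)" for k
    proof -
      have "f (X k) + ereal (G k \<bullet> (y - X k)) \<le> f y"
        using mem by (auto simp: subdifferential_def)
      then show ?thesis by (cases "f (X k)") (auto simp: real c_def)
    qed
    then have "Liminf sequentially (\<lambda>k. f (X k)) \<le> Liminf sequentially (\<lambda>k. ereal (c k))"
      by (intro Liminf_mono) auto
    moreover have "(\<lambda>k. ereal (c k)) \<longlonglongrightarrow> ereal (s - g \<bullet> (y - x))"
      unfolding c_def by (intro tendsto_intros X G)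
    ultimately have "f x \<le> ereal (s - g \<bullet> (y - x))"
      using closed_proper_convex_lsc[OF f X] lim_imp_Liminf[OF sequentially_bot]
      by (metis order_trans)
    then show ?thesis using closed_proper_convex_not_MInf[OF f, of x]
      by (cases "f x") (auto simp: real)
  qed (use closed_proper_convex_not_MInf[OF f] in auto)
qed

lemma normal_cone_iff:
  fixes C :: "'a::euclidean_space set"
  assumes C: "C \<noteq> {}"
  shows "v \<in> normal_cone C x \<longleftrightarrow> x \<in> C \<and> (\<forall>y\<in>C. v \<bullet> (y - x) \<le> 0)"
proof (cases "x \<in> C")
  case True
  then show ?thesis by (auto simp: normal_cone_def subdifferential_def indicator_fun_def)
next
  case False
  then show ?thesis using C by (auto simp: normal_cone_def subdifferential_def indicator_fun_def)
qed

text \<open>Normal vectors are the residuals of the metric projection.\<close>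

lemma normal_cone_closest_point:
  fixes C :: "'a::euclidean_space set"
  assumes C: "closed C" "convex C" "C \<noteq> {}"
  shows "v \<in> normal_cone C x \<longleftrightarrow> closest_point C (x + v) = x"
proof
  assume "v \<in> normal_cone C x"
  then have x: "x \<in> C" and v: "\<And>y. y \<in> C \<Longrightarrow> v \<bullet> (y - x) \<le> 0"
    using normal_cone_iff[OF C(3)] by auto
  define q where "q = closest_point C (x + v)"
  have q: "q \<in> C" unfolding q_def using C by (intro closest_point_in_set)
  have "(x + v - q) \<bullet> (x - q) \<le> 0"
    unfolding q_def using C x by (intro closest_point_dot)
  moreover have "(x + v - q) \<bullet> (x - q) = (x - q) \<bullet> (x - q) - v \<bullet> (q - x)"
    by (simp add: inner_diff_left inner_diff_right inner_add_left)
  ultimately have "(x - q) \<bullet> (x - q) \<le> 0" using v[OF q] by linarith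
  then have "x - q = 0" by (metis inner_eq_zero_iff inner_ge_zero antisym)
  then show "closest_point C (x + v) = x" by (simp add: q_def)
next
  assume *: "closest_point C (x + v) = x"
  show "v \<in> normal_cone C x"
    using closest_point_in_set[OF C(1,3), of "x + v"] closest_point_dot[OF C(2,1), of _ "x + v"]
    by (auto simp: normal_cone_iff[OF C(3)] *)
qed

section \<open>The proximal mapping\<close>

text \<open>A point at which the infimum in the Moreau envelope is attained. For a closed proper convex
  function and a positive parameter such a point exists and is unique; otherwise the value may be
  arbitrary.\<close>

definition prox :: "real \<Rightarrow> ('a::euclidean_space \<Rightarrow> ereal) \<Rightarrow> 'a \<Rightarrow> 'a" where
  "prox l f x = (SOME u. moreau_envelope l f x = f u + ereal (1 / (2 * l) * (norm (x - u))\<^sup>2))"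

lemma moreau_envelope_prox:
  fixes f :: "'a::euclidean_space \<Rightarrow> ereal"
  assumes f: "closed_proper_convex f" and l: "0 < l"
  obtains r where "f (prox l f x) = ereal r"
    "moreau_envelope l f x = ereal (r + 1 / (2 * l) * (norm (x - prox l f x))\<^sup>2)"
proof -
  have eq: "moreau_envelope l f x
      = f (prox l f x) + ereal (1 / (2 * l) * (norm (x - prox l f x))\<^sup>2)"
    unfolding prox_def by (rule someI_ex) (use moreau_envelope_attained[OF f l, of x] in blast)
  have "\<bar>moreau_envelope l f x\<bar> \<noteq> \<infinity>" using moreau_envelope_attained[OF f l, of x] by (elim exE conjE)
  then obtain r where "f (prox l f x) = ereal r"
    using eq by (cases "f (prox l f x)") auto
  then show ?thesis using that eq by simp
qed

lemma moreau_envelope_le: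
  "moreau_envelope l f x \<le> f u + ereal (1 / (2 * l) * (norm (x - u))\<^sup>2)"
  unfolding moreau_envelope_def by (rule INF_lower) simp

lemma moreau_envelope_le_self: "moreau_envelope l f x \<le> f x"
  using moreau_envelope_le[of l f x x] by simp

lemma prox_in_domain:
  assumes "closed_proper_convex f" "0 < l"
  shows "prox l f x \<in> effective_domain f"
  by (rule moreau_envelope_prox[OF assms, of x]) (simp add: effective_domain_def)

text \<open>Fermat's rule for the proximal problem: comparing the minimizer with points of the segment
  towards \<open>y\<close> and letting them tend to the minimizer gives the subgradient inequality at \<open>y\<close>.\<close>

lemma prox_subgradient:
  fixes f :: "'a::euclidean_space \<Rightarrow> ereal"
  assumes f: "closed_proper_convex f" and l: "0 < l"
  shows "(x - prox l f x) /\<^sub>R l \<in> subdifferential f (prox l f x)"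
  unfolding subdifferential_def
proof (intro CollectI allI)
  fix y
  define p where "p = prox l f x"
  obtain r where r: "f p = ereal r"
    "moreau_envelope l f x = ereal (r + 1 / (2 * l) * (norm (x - p))\<^sup>2)"
    using moreau_envelope_prox[OF f l, of x] unfolding p_def by blast
  have "f p + ereal (((x - p) /\<^sub>R l) \<bullet> (y - p)) \<le> f y"
  proof (cases "f y")
    case (real s)
    define Q where "Q = ((x - p) /\<^sub>R l) \<bullet> (y - p)"
    have Q: "Q = (x - p) \<bullet> (y - p) / l" by (simp add: Q_def inner_scaleR_left divide_inverse_commute)
    define N where "N = 1 / (2 * l) * (norm (y - p))\<^sup>2"
    define A where "A = 1 / (2 * l) * (norm (x - p))\<^sup>2"
    have ineq: "r + Q \<le> s + t * N" if t: "0 < t" "t \<le> 1" for t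
    proof -
      define u where "u = (1 - t) *\<^sub>R p + t *\<^sub>R y"
      have "f u \<le> ereal ((1 - t) * r + t * s)"
        unfolding u_def using closed_proper_convex_convexD[OF f r(1) real] t by simp
      then have "f u + ereal (1 / (2 * l) * (norm (x - u))\<^sup>2)
          \<le> ereal ((1 - t) * r + t * s) + ereal (1 / (2 * l) * (norm (x - u))\<^sup>2)"
        by (rule add_right_mono)
      with moreau_envelope_le[of l f x u]
      have "ereal (r + 1 / (2 * l) * (norm (x - p))\<^sup>2)
          \<le> ereal ((1 - t) * r + t * s) + ereal (1 / (2 * l) * (norm (x - u))\<^sup>2)"
        unfolding r(2) by (rule order_trans)
      then have 1: "r + 1 / (2 * l) * (norm (x - p))\<^sup>2
          \<le> (1 - t) * r + t * s + 1 / (2 * l) * (norm (x - u))\<^sup>2" by simp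
      have sq: "(norm (v - t *\<^sub>R w))\<^sup>2 = (norm v)\<^sup>2 - 2 * t * (v \<bullet> w) + t\<^sup>2 * (norm w)\<^sup>2"
        for v w :: 'a
        unfolding power2_norm_eq_inner
        by (simp add: inner_diff_left inner_diff_right inner_commute power2_eq_square)
      have "x - u = (x - p) - t *\<^sub>R (y - p)" by (simp add: u_def algebra_simps)
      then have "(norm (x - u))\<^sup>2
          = (norm (x - p))\<^sup>2 - 2 * t * ((x - p) \<bullet> (y - p)) + t\<^sup>2 * (norm (y - p))\<^sup>2"
        by (simp only: sq)
      then have 2: "1 / (2 * l) * (norm (x - u))\<^sup>2 = A - t * Q + t\<^sup>2 * N"
        using l by (simp add: A_def Q N_def diff_divide_distrib add_divide_distrib)
      have "t * (r + Q) \<le> t * (s + t * N)"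
        using 1 unfolding 2 A_def[symmetric] by (simp add: algebra_simps power2_eq_square)
      then show ?thesis using t by simp
    qed
    have "((\<lambda>t. s + t * N) \<longlongrightarrow> s + 0 * N) (at_right 0)" by (intro tendsto_intros)
    moreover have "\<forall>\<^sub>F t in at_right 0. r + Q \<le> s + t * N"
      unfolding eventually_at_right_field using ineq by (intro exI[of _ 1]) auto
    ultimately have "r + Q \<le> s"
      using tendsto_lowerbound[of "\<lambda>t. s + t * N" s "at_right 0" "r + Q"] by simp
    then show ?thesis unfolding Q_def r(1) real by simp
  next
    case PInf
    then show ?thesis by (simp only: ereal_less_eq)
  next
    case MInf
    then show ?thesis using closed_proper_convex_not_MInf[OF f, of y] by contradiction
  qed
  then show "f (prox l f x) + ereal (((x - prox l f x) /\<^sub>R l) \<bullet> (y - prox l f x)) \<le> f y"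
    unfolding p_def .
qed

text \<open>Thus \<open>prox l f\<close> is the resolvent of the subdifferential.\<close>

lemma prox_eqI:
  fixes f :: "'a::euclidean_space \<Rightarrow> ereal"
  assumes f: "closed_proper_convex f" and l: "0 < l" and g: "g \<in> subdifferential f x"
  shows "prox l f (x + l *\<^sub>R g) = x"
proof -
  define p where "p = prox l f (x + l *\<^sub>R g)"
  have "0 \<le> (g - (x + l *\<^sub>R g - p) /\<^sub>R l) \<bullet> (x - p)"
    using subdifferential_mono[OF f g prox_subgradient[OF f l, of "x + l *\<^sub>R g"]]
    by (simp add: p_def)
  also have "g - (x + l *\<^sub>R g - p) /\<^sub>R l = - ((x - p) /\<^sub>R l)"
    using l by (simp add: algebra_simps)
  finally have "inverse l * ((x - p) \<bullet> (x - p)) \<le> 0" by simp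
  then have "(x - p) \<bullet> (x - p) \<le> 0" using l by (simp add: mult_le_0_iff)
  then have "x - p = 0" by (metis inner_eq_zero_iff inner_ge_zero antisym)
  then show ?thesis by (simp add: p_def)
qed

lemma scaled_subdifferential_graph_iff:
  fixes f :: "'a::euclidean_space \<Rightarrow> ereal"
  assumes f: "closed_proper_convex f" and l: "0 < l"
  shows "(x, v) \<in> svm_graph (\<lambda>x. (\<lambda>g. l *\<^sub>R g) ` subdifferential f x) \<longleftrightarrow> prox l f (x + v) = x"
proof
  assume "(x, v) \<in> svm_graph (\<lambda>x. (\<lambda>g. l *\<^sub>R g) ` subdifferential f x)"
  then show "prox l f (x + v) = x" using prox_eqI[OF f l] by (auto simp: svm_graph_def)
next
  assume *: "prox l f (x + v) = x"
  have "v /\<^sub>R l \<in> subdifferential f x"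
    using prox_subgradient[OF f l, of "x + v"] by (simp add: *)
  then have "v \<in> (\<lambda>g. l *\<^sub>R g) ` subdifferential f x"
    using l by (intro image_eqI[of _ _ "v /\<^sub>R l"]) auto
  then show "(x, v) \<in> svm_graph (\<lambda>x. (\<lambda>g. l *\<^sub>R g) ` subdifferential f x)"
    by (simp add: svm_graph_def)
qed

section \<open>The gradient of the Moreau envelope\<close>

text \<open>With \<open>v = (x - prox l f x) / l\<close>, the envelope satisfies
  \<open>0 \<le> e(y) - e(x) - v \<bullet> (y - x) \<le> \<parallel>y - x\<parallel>\<^sup>2 / (2 l)\<close> for all \<open>y\<close>, and differentiability follows. The
  upper estimate tests the envelope at \<open>y\<close> with the proximal point of \<open>x\<close>; the lower one uses that
  \<open>v\<close> is a subgradient of \<open>f\<close> at that proximal point.\<close>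

lemma has_gradient_moreau_envelope:
  fixes f :: "'a::euclidean_space \<Rightarrow> ereal"
  assumes f: "closed_proper_convex f" and l: "0 < l"
  shows "has_gradient (moreau_envelope l f) x ((x - prox l f x) /\<^sub>R l)"
proof -
  define p where "p = prox l f x"
  define v where "v = (x - p) /\<^sub>R l"
  define E where "E = (\<lambda>y. real_of_ereal (moreau_envelope l f y))"
  have xp: "x - p = l *\<^sub>R v" using l by (simp add: v_def)
  obtain r where r: "f p = ereal r"
    "moreau_envelope l f x = ereal (r + 1 / (2 * l) * (norm (x - p))\<^sup>2)"
    using moreau_envelope_prox[OF f l, of x] unfolding p_def by blast
  have fin: "\<bar>moreau_envelope l f y\<bar> \<noteq> \<infinity>" for y
    by (rule moreau_envelope_prox[OF f l, of y]) simp
  have Ex: "E x = r + 1 / (2 * l) * (norm (x - p))\<^sup>2" by (simp add: E_def r)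
  have upper: "E y - E x - (y - x) \<bullet> v \<le> 1 / (2 * l) * (norm (y - x))\<^sup>2" for y
  proof -
    have "moreau_envelope l f y \<le> ereal (r + 1 / (2 * l) * (norm (y - p))\<^sup>2)"
      using moreau_envelope_le[of l f y p] by (simp add: r)
    then have "E y \<le> r + 1 / (2 * l) * (norm (y - p))\<^sup>2"
      using fin[of y] by (cases "moreau_envelope l f y") (auto simp: E_def)
    moreover have "(norm (y - p))\<^sup>2 = (norm (y - x))\<^sup>2 + 2 * l * ((y - x) \<bullet> v) + (norm (x - p))\<^sup>2"
    proof -
      have "y - p = (y - x) + (x - p)" by simp
      then show ?thesis unfolding power2_norm_eq_inner
        by (simp only: inner_add_left inner_add_right) (simp add: xp inner_commute)
    qed
    then have "1 / (2 * l) * (norm (y - p))\<^sup>2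
        = 1 / (2 * l) * (norm (y - x))\<^sup>2 + (y - x) \<bullet> v + 1 / (2 * l) * (norm (x - p))\<^sup>2"
      using l by (simp add: field_simps)
    ultimately show ?thesis by (simp add: Ex)
  qed
  have lower: "0 \<le> E y - E x - (y - x) \<bullet> v" for y
  proof -
    define q where "q = prox l f y"
    define w where "w = (y - q) /\<^sub>R l"
    have yq: "y - q = l *\<^sub>R w" using l by (simp add: w_def)
    obtain s where s: "f q = ereal s"
      "moreau_envelope l f y = ereal (s + 1 / (2 * l) * (norm (y - q))\<^sup>2)"
      using moreau_envelope_prox[OF f l, of y] unfolding q_def by blast
    have Ey: "E y = s + 1 / (2 * l) * (norm (y - q))\<^sup>2" by (simp add: E_def s)
    have "r + v \<bullet> (q - p) \<le> s"
      using prox_subgradient[OF f l, of x] unfolding subdifferential_def p_def[symmetric]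
      by (auto simp: r s v_def dest: spec[of _ q])
    moreover have "q - p = (y - x) - l *\<^sub>R w + l *\<^sub>R v"
      unfolding xp[symmetric] yq[symmetric] by simp
    then have "v \<bullet> (q - p) = (y - x) \<bullet> v - l * (v \<bullet> w) + l * (v \<bullet> v)"
      by (simp add: inner_add_right inner_diff_right inner_commute)
    moreover have "E x = r + l / 2 * (v \<bullet> v)" "E y = s + l / 2 * (w \<bullet> w)"
      using l by (simp_all add: Ex Ey xp yq power_mult_distrib power2_norm_eq_inner[symmetric]
          power2_eq_square)
    moreover have "0 \<le> l / 2 * ((w - v) \<bullet> (w - v))" using l by simp
    then have "0 \<le> l / 2 * (w \<bullet> w) - l * (v \<bullet> w) + l / 2 * (v \<bullet> v)"
      by (simp add: inner_diff_left inner_diff_right inner_commute algebra_simps)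
    ultimately show ?thesis by (simp add: field_simps)
  qed
  have "(E has_derivative (\<lambda>h. h \<bullet> v)) (at x)"
    unfolding has_derivative_within
  proof (intro conjI bounded_linear_inner_left)
    have lim: "((\<lambda>y. 1 / (2 * l) * norm (y - x)) \<longlongrightarrow> 1 / (2 * l) * norm (x - x)) (at x)"
      by (intro tendsto_intros)
    show "((\<lambda>y. (1 / norm (y - x)) *\<^sub>R (E y - (E x + (y - x) \<bullet> v))) \<longlongrightarrow> 0) (at x)"
    proof (rule Lim_null_comparison)
      show "\<forall>\<^sub>F y in at x. norm ((1 / norm (y - x)) *\<^sub>R (E y - (E x + (y - x) \<bullet> v)))
          \<le> 1 / (2 * l) * norm (y - x)"
        unfolding eventually_at_filter
      proof (intro always_eventually allI impI)
        fix y assume "y \<noteq> x"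
        then have n: "0 < norm (y - x)" by simp
        have "norm ((1 / norm (y - x)) *\<^sub>R (E y - (E x + (y - x) \<bullet> v)))
            = (E y - E x - (y - x) \<bullet> v) / norm (y - x)"
          using lower[of y] by (simp add: abs_mult diff_diff_eq)
        also have "\<dots> \<le> (1 / (2 * l) * (norm (y - x))\<^sup>2) / norm (y - x)"
          using upper[of y] n by (intro divide_right_mono) auto
        also have "\<dots> = 1 / (2 * l) * norm (y - x)" using n by (simp add: power2_eq_square)
        finally show "norm ((1 / norm (y - x)) *\<^sub>R (E y - (E x + (y - x) \<bullet> v)))
            \<le> 1 / (2 * l) * norm (y - x)" .
      qed
      show "((\<lambda>y. 1 / (2 * l) * norm (y - x)) \<longlongrightarrow> 0) (at x)" using lim by simp
    qed
  qed
  then have "GDERIV E x :> v" by (simp add: gderiv_def)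
  then show ?thesis
    using fin by (simp add: has_gradient_def E_def v_def p_def)
qed

section \<open>Asymptotics of the scaled envelope and of the proximal mapping\<close>

text \<open>An affine minorant bounds the scaled envelope from below with an error that vanishes with
  \<open>l\<close>: the cross term \<open>a \<bullet> (x - u)\<close> is absorbed by Young's inequality.\<close>

lemma scaled_envelope_lower_bound:
  fixes f :: "'a::euclidean_space \<Rightarrow> ereal"
  assumes f: "closed_proper_convex f" and l: "0 < l"
    and ab: "\<And>u. ereal (a \<bullet> u + b) \<le> f u"
  shows "l * (a \<bullet> x + b) - l * (norm a)\<^sup>2 / 2 + (1 - l) * (norm (x - prox l f x))\<^sup>2 / 2
    \<le> l * real_of_ereal (moreau_envelope l f x)"
proof -
  define p where "p = prox l f x"
  obtain r where r: "f p = ereal r"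
    "moreau_envelope l f x = ereal (r + 1 / (2 * l) * (norm (x - p))\<^sup>2)"
    using moreau_envelope_prox[OF f l, of x] unfolding p_def by blast
  have "a \<bullet> p + b \<le> r" using ab[of p] by (simp add: r)
  then have 1: "l * (a \<bullet> p + b) \<le> l * r" using l by simp
  have "0 \<le> (norm (a - (x - p)))\<^sup>2" by simp
  also have "\<dots> = (norm a)\<^sup>2 - 2 * (a \<bullet> (x - p)) + (norm (x - p))\<^sup>2"
    unfolding power2_norm_eq_inner by (simp add: inner_diff_left inner_diff_right inner_commute)
  finally have "l * (2 * (a \<bullet> (x - p))) \<le> l * ((norm a)\<^sup>2 + (norm (x - p))\<^sup>2)" using l by simp
  then have "l * (a \<bullet> x + b) - l * (norm a)\<^sup>2 / 2 + (1 - l) * (norm (x - p))\<^sup>2 / 2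
      \<le> l * (a \<bullet> p + b) + (norm (x - p))\<^sup>2 / 2"
    by (simp add: inner_diff_right field_simps)
  also have "\<dots> \<le> l * r + (norm (x - p))\<^sup>2 / 2" using 1 by simp
  also have "\<dots> = l * real_of_ereal (moreau_envelope l f x)"
    using l by (simp add: r field_simps)
  finally show ?thesis by (simp add: p_def)
qed

lemma scaled_envelope_upper_bound:
  fixes f :: "'a::euclidean_space \<Rightarrow> ereal"
  assumes f: "closed_proper_convex f" and l: "0 < l" and u: "f u = ereal r"
  shows "l * real_of_ereal (moreau_envelope l f x) \<le> l * r + (norm (x - u))\<^sup>2 / 2"
proof -
  obtain e where e: "moreau_envelope l f x = ereal e"
    using moreau_envelope_prox[OF f l, of x] by blast
  have "e \<le> r + 1 / (2 * l) * (norm (x - u))\<^sup>2"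
    using moreau_envelope_le[of l f x u] by (simp add: e u)
  then have "l * e \<le> l * (r + 1 / (2 * l) * (norm (x - u))\<^sup>2)" using l by simp
  then show ?thesis using l by (simp add: e algebra_simps)
qed

text \<open>The convergence is joint in the point and the parameter, along any filter; both the limit over
  a product filter and limits along sequences are instances.\<close>

lemma scaled_envelope_tendsto:
  fixes f :: "'a::euclidean_space \<Rightarrow> ereal"
  assumes f: "closed_proper_convex f"
    and X: "(X \<longlongrightarrow> x) F" and l: "(l \<longlongrightarrow> 0) F" and pos: "\<forall>\<^sub>F k in F. 0 < l k"
  shows "((\<lambda>k. l k * real_of_ereal (moreau_envelope (l k) f (X k)))
    \<longlongrightarrow> 1 / 2 * (infdist x (closure (effective_domain f)))\<^sup>2) F"
proof (rule order_tendstoI)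
  define C where "C = closure (effective_domain f)"
  obtain a b where ab: "\<And>u. ereal (a \<bullet> u + b) \<le> f u"
    using closed_proper_convex_affine_minorant[OF f] by blast
  define L where "L = (\<lambda>k. l k * (a \<bullet> X k + b) - l k * (norm a)\<^sup>2 / 2
      + (1 - l k) * (infdist (X k) C)\<^sup>2 / 2)"
  fix c :: real assume c: "c < 1 / 2 * (infdist x (closure (effective_domain f)))\<^sup>2"
  have "(L \<longlongrightarrow> 0 * (a \<bullet> x + b) - 0 * (norm a)\<^sup>2 / 2 + (1 - 0) * (infdist x C)\<^sup>2 / 2) F"
    unfolding L_def by (intro tendsto_intros X l) simp_all
  then have "(L \<longlongrightarrow> 1 / 2 * (infdist x C)\<^sup>2) F" by simp
  then have "\<forall>\<^sub>F k in F. c < L k" using c unfolding C_def by (rule order_tendstoD(1))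
  moreover have "\<forall>\<^sub>F k in F. l k < 1" using l by (rule order_tendstoD(2)) simp
  ultimately show "\<forall>\<^sub>F k in F. c < l k * real_of_ereal (moreau_envelope (l k) f (X k))"
    using pos
  proof eventually_elim
    case (elim k)
    have "prox (l k) f (X k) \<in> C"
      using prox_in_domain[OF f] elim closure_subset unfolding C_def by blast
    then have "infdist (X k) C \<le> norm (X k - prox (l k) f (X k))"
      using infdist_le by (metis dist_norm)
    then have "(infdist (X k) C)\<^sup>2 \<le> (norm (X k - prox (l k) f (X k)))\<^sup>2"
      by (intro power_mono infdist_nonneg)
    then have "(1 - l k) * (infdist (X k) C)\<^sup>2 \<le> (1 - l k) * (norm (X k - prox (l k) f (X k)))\<^sup>2"
      using elim by (intro mult_left_mono) auto
    then have "L k \<le> l k * real_of_ereal (moreau_envelope (l k) f (X k))"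
      using scaled_envelope_lower_bound[OF f elim(3) ab, of "X k"] unfolding L_def by linarith
    then show ?case using elim by simp
  qed
next
  define C where "C = closure (effective_domain f)"
  fix c :: real assume c: "1 / 2 * (infdist x (closure (effective_domain f)))\<^sup>2 < c"
  have C: "closed C" "C \<noteq> {}"
    using closed_proper_convex_nonempty_domain[OF f] by (auto simp: C_def)
  \<comment> \<open>The projection need not lie in the effective domain itself, so a nearby point \<open>u\<close> of the
    domain serves as test point.\<close>
  have "closest_point C x \<in> C" using C by (intro closest_point_in_set)
  moreover have "infdist x C = norm (x - closest_point C x)"
    using C by (simp add: infdist_eq_setdist setdist_closest_point dist_norm)
  ultimately have "closest_point C x \<in> {u. (norm (x - u))\<^sup>2 / 2 < c} \<inter> C"
    using c by (simp add: C_def)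
  moreover have "open {u. (norm (x - u))\<^sup>2 / 2 < c}"
    by (intro open_Collect_less continuous_intros) simp
  ultimately obtain u where u: "u \<in> effective_domain f" "(norm (x - u))\<^sup>2 / 2 < c"
    using open_Int_closure_eq_empty[of "{u. (norm (x - u))\<^sup>2 / 2 < c}" "effective_domain f"]
    unfolding C_def by blast
  obtain r where r: "f u = ereal r" using effective_domain_realE[OF f u(1)] .
  have "((\<lambda>k. l k * r + (norm (X k - u))\<^sup>2 / 2) \<longlongrightarrow> 0 * r + (norm (x - u))\<^sup>2 / 2) F"
    by (intro tendsto_intros X l) simp
  then have "\<forall>\<^sub>F k in F. l k * r + (norm (X k - u))\<^sup>2 / 2 < c"
    by (rule order_tendstoD(2)) (use u in simp)
  then show "\<forall>\<^sub>F k in F. l k * real_of_ereal (moreau_envelope (l k) f (X k)) < c"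
    using pos
    by eventually_elim (use scaled_envelope_upper_bound[OF f _ r] in \<open>fastforce intro: le_less_trans\<close>)
qed

text \<open>The proximal points become minimizing for the distance to the closed domain; by the obtuse
  angle criterion \<open>\<parallel>p - \<Pi>x\<parallel>\<^sup>2 \<le> \<parallel>x - p\<parallel>\<^sup>2 - \<parallel>x - \<Pi>x\<parallel>\<^sup>2\<close> they approach the projection.\<close>

lemma prox_tendsto_closest_point:
  fixes f :: "'a::euclidean_space \<Rightarrow> ereal"
  assumes f: "closed_proper_convex f"
    and X: "(X \<longlongrightarrow> x) F" and l: "(l \<longlongrightarrow> 0) F" and pos: "\<forall>\<^sub>F k in F. 0 < l k"
  shows "((\<lambda>k. prox (l k) f (X k)) \<longlongrightarrow> closest_point (closure (effective_domain f)) x) F"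
proof -
  define C where "C = closure (effective_domain f)"
  have C: "closed C" "convex C" "C \<noteq> {}"
    using closed_proper_convex_nonempty_domain[OF f] convex_effective_domain[OF f]
    by (auto simp: C_def convex_closure)
  obtain a b where ab: "\<And>u. ereal (a \<bullet> u + b) \<le> f u"
    using closed_proper_convex_affine_minorant[OF f] by blast
  define E where "E = (\<lambda>k. l k * real_of_ereal (moreau_envelope (l k) f (X k)))"
  define B where "B = (\<lambda>k. 2 * (E k - l k * (a \<bullet> X k + b) + l k * (norm a)\<^sup>2 / 2) / (1 - l k)
      - (infdist (X k) C)\<^sup>2)"
  have "(E \<longlongrightarrow> 1 / 2 * (infdist x C)\<^sup>2) F"
    unfolding E_def C_def by (rule scaled_envelope_tendsto[OF f X l pos])
  then have "(B \<longlongrightarrow> 2 * (1 / 2 * (infdist x C)\<^sup>2 - 0 * (a \<bullet> x + b) + 0 * (norm a)\<^sup>2 / 2) / (1 - 0)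
      - (infdist x C)\<^sup>2) F"
    unfolding B_def by (intro tendsto_intros X l) simp_all
  then have "((\<lambda>k. sqrt (B k)) \<longlongrightarrow> 0) F"
    using tendsto_real_sqrt[of B 0 F] by simp
  moreover have "\<forall>\<^sub>F k in F. l k < 1" using l by (rule order_tendstoD(2)) simp
  then have "\<forall>\<^sub>F k in F. norm (prox (l k) f (X k) - closest_point C (X k)) \<le> sqrt (B k)"
    using pos
  proof eventually_elim
    case (elim k)
    define p where "p = prox (l k) f (X k)"
    define q where "q = closest_point C (X k)"
    have "p \<in> C"
      using prox_in_domain[OF f] elim closure_subset unfolding C_def p_def by blast
    then have "(X k - q) \<bullet> (p - q) \<le> 0"
      unfolding q_def using C by (intro closest_point_dot)
    moreover have "(norm (X k - p))\<^sup>2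
        = (norm (X k - q))\<^sup>2 - 2 * ((X k - q) \<bullet> (p - q)) + (norm (p - q))\<^sup>2"
      unfolding power2_norm_eq_inner by (simp add: inner_diff_left inner_diff_right inner_commute)
    moreover have "norm (X k - q) = infdist (X k) C"
      using C by (simp add: infdist_eq_setdist setdist_closest_point dist_norm q_def)
    moreover have "(norm (X k - p))\<^sup>2
        \<le> 2 * (E k - l k * (a \<bullet> X k + b) + l k * (norm a)\<^sup>2 / 2) / (1 - l k)"
    proof -
      have "(1 - l k) * (norm (X k - p))\<^sup>2
          \<le> 2 * (E k - l k * (a \<bullet> X k + b) + l k * (norm a)\<^sup>2 / 2)"
        using scaled_envelope_lower_bound[OF f elim(2) ab, of "X k"]
        unfolding E_def p_def by simp
      then show ?thesis using elim by (simp add: pos_le_divide_eq mult.commute)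
    qed
    ultimately have "(norm (p - q))\<^sup>2 \<le> B k" unfolding B_def by simp
    then show ?case unfolding p_def q_def by (rule real_le_rsqrt)
  qed
  ultimately have "((\<lambda>k. prox (l k) f (X k) - closest_point C (X k)) \<longlongrightarrow> 0) F"
    by (rule Lim_null_comparison[rotated])
  moreover have "((\<lambda>k. closest_point C (X k)) \<longlongrightarrow> closest_point C x) F"
    using continuous_at_closest_point[OF C(2,1,3)] X by (rule isCont_tendsto_compose)
  ultimately show ?thesis
    using tendsto_add by (fastforce simp: C_def)
qed

section \<open>Convergence of the envelopes\<close>

lemma moreau_envelope_liminf:
  fixes f :: "'a::euclidean_space \<Rightarrow> ereal"
  assumes f: "closed_proper_convex f"
    and X: "(X \<longlongrightarrow> x) F" and l: "(l \<longlongrightarrow> 0) F" and pos: "\<forall>\<^sub>F k in F. 0 < l k"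
  shows "f x \<le> Liminf F (\<lambda>k. moreau_envelope (l k) f (X k))"
proof (cases "x \<in> closure (effective_domain f)")
  case True
  have "((\<lambda>k. prox (l k) f (X k)) \<longlongrightarrow> x) F"
    using prox_tendsto_closest_point[OF f X l pos] closest_point_self[OF True] by simp
  then have "f x \<le> Liminf F (\<lambda>k. f (prox (l k) f (X k)))"
    by (rule closed_proper_convex_lsc[OF f])
  also have "\<dots> \<le> Liminf F (\<lambda>k. moreau_envelope (l k) f (X k))"
  proof (rule Liminf_mono)
    show "\<forall>\<^sub>F k in F. f (prox (l k) f (X k)) \<le> moreau_envelope (l k) f (X k)"
      using pos
    proof eventually_elim
      case (elim k)
      show ?case by (rule moreau_envelope_prox[OF f elim, of "X k"]) (use elim in simp)
    qed
  qed
  finally show ?thesis .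
next
  case False
  define d where "d = 1 / 2 * (infdist x (closure (effective_domain f)))\<^sup>2"
  have "0 < infdist x (closure (effective_domain f))"
    using False closed_proper_convex_nonempty_domain[OF f]
    by (metis closed_closure closure_eq_empty in_closed_iff_infdist_zero infdist_nonneg
        order_le_less)
  then have d: "0 < d" by (simp add: d_def)
  show ?thesis unfolding le_Liminf_iff
  proof (intro allI impI)
    fix y assume "y < f x"
    then obtain z where z: "y < ereal z" using ereal_dense2 by blast
    \<comment> \<open>Eventually the scaled envelope stays above \<open>d / 2 > 0\<close>, while \<open>l k * z\<close> tends to zero.\<close>
    have "\<forall>\<^sub>F k in F. d / 2 < l k * real_of_ereal (moreau_envelope (l k) f (X k))"
    proof (rule order_tendstoD(1))
      show "((\<lambda>k. l k * real_of_ereal (moreau_envelope (l k) f (X k))) \<longlongrightarrow> d) F"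
        unfolding d_def by (rule scaled_envelope_tendsto[OF f X l pos])
    qed (use d in simp)
    moreover have "((\<lambda>k. l k * z) \<longlongrightarrow> 0 * z) F" by (intro tendsto_intros l)
    then have "\<forall>\<^sub>F k in F. l k * z < d / 2" by (rule order_tendstoD(2)) (use d in simp)
    ultimately show "\<forall>\<^sub>F k in F. y < moreau_envelope (l k) f (X k)"
      using pos
    proof eventually_elim
      case (elim k)
      obtain e where e: "moreau_envelope (l k) f (X k) = ereal e"
        using moreau_envelope_prox[OF f elim(3)] by blast
      have "l k * z < l k * e" using elim(1,2) by (simp add: e)
      then have "z < e" using elim(3) by (rule mult_left_less_imp_less[OF _ less_imp_le])
      then show ?case using z e by (auto intro: less_trans)
    qed
  qed
qed

lemma moreau_envelope_tendsto:
  fixes f :: "'a::euclidean_space \<Rightarrow> ereal"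
  assumes f: "closed_proper_convex f" and l: "(l \<longlongrightarrow> 0) F" and pos: "\<forall>\<^sub>F k in F. 0 < l k"
  shows "((\<lambda>k. moreau_envelope (l k) f x) \<longlongrightarrow> f x) F"
proof (rule order_tendstoI)
  fix c assume "c < f x"
  then show "\<forall>\<^sub>F k in F. c < moreau_envelope (l k) f x"
    using moreau_envelope_liminf[OF f tendsto_const l pos] unfolding le_Liminf_iff by blast
next
  fix c assume "f x < c"
  then show "\<forall>\<^sub>F k in F. moreau_envelope (l k) f x < c"
    using le_less_trans[OF moreau_envelope_le_self] by (intro always_eventually) blast
qed

lemma moreau_envelope_antimono:
  fixes f :: "'a::euclidean_space \<Rightarrow> ereal"
  shows "antimono_on {0<..} (\<lambda>l. moreau_envelope l f x)"
proof (rule monotone_onI)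
  fix l m :: real assume "l \<in> {0<..}" "m \<in> {0<..}" "l \<le> m"
  then have le: "1 / (2 * m) * (norm (x - u))\<^sup>2 \<le> 1 / (2 * l) * (norm (x - u))\<^sup>2" for u
    by (intro mult_right_mono divide_left_mono) auto
  show "moreau_envelope m f x \<le> moreau_envelope l f x"
    unfolding moreau_envelope_def
    by (intro INF_mono' add_left_mono iffD2[OF ereal_less_eq(3)] le)
qed

lemma moreau_envelope_epi_converges:
  fixes f :: "'a::euclidean_space \<Rightarrow> ereal"
  assumes f: "closed_proper_convex f"
  shows "family_epi_converges (\<lambda>l. moreau_envelope l f) f"
  unfolding family_epi_converges_def epi_converges_def
proof (intro allI impI conjI)
  fix l X and x :: 'a assume l: "down_to_zero l" and X: "X \<longlonglongrightarrow> x"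
  show "f x \<le> liminf (\<lambda>k. moreau_envelope (l k) f (X k))"
    using l by (intro moreau_envelope_liminf[OF f X]) (auto simp: down_to_zero_def)
next
  fix l and x :: 'a assume l: "down_to_zero l"
  have "limsup (\<lambda>k. moreau_envelope (l k) f x) = f x"
    using l by (intro lim_imp_Limsup moreau_envelope_tendsto f) (auto simp: down_to_zero_def)
  then show "\<exists>X. X \<longlonglongrightarrow> x \<and> limsup (\<lambda>k. moreau_envelope (l k) f (X k)) \<le> f x"
    by (intro exI[of _ "\<lambda>_. x"]) simp
qed

section \<open>Convergence of the scaled functions and subdifferentials\<close>

text \<open>At a point \<open>x\<close> of the closed domain the proximal points of \<open>x\<close> serve as recovery sequence,
  because the scaled function at them is dominated by the scaled envelope at \<open>x\<close>, which tends to
  half the squared distance of \<open>x\<close> to the closed domain, that is, to zero.\<close>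

lemma scaled_epi_converges:
  fixes f :: "'a::euclidean_space \<Rightarrow> ereal"
  assumes f: "closed_proper_convex f"
  shows "family_epi_converges (\<lambda>l x. ereal l * f x)
    (indicator_fun (closure (effective_domain f)))"
  unfolding family_epi_converges_def epi_converges_def
proof (intro allI impI conjI)
  fix l X and x :: 'a assume l: "down_to_zero l" and X: "X \<longlonglongrightarrow> x"
  have pos: "0 < l k" and l0: "l \<longlonglongrightarrow> 0" for k using l by (auto simp: down_to_zero_def)
  show "indicator_fun (closure (effective_domain f)) x \<le> liminf (\<lambda>k. ereal (l k) * f (X k))"
  proof (cases "x \<in> closure (effective_domain f)")
    case True
    obtain a b where ab: "\<And>u. ereal (a \<bullet> u + b) \<le> f u"
      using closed_proper_convex_affine_minorant[OF f] by blast
    have "(\<lambda>k. ereal (l k * (a \<bullet> X k + b))) \<longlonglongrightarrow> ereal (0 * (a \<bullet> x + b))"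
      by (intro tendsto_intros X l0)
    from lim_imp_Liminf[OF sequentially_bot this]
    have "0 = liminf (\<lambda>k. ereal (l k * (a \<bullet> X k + b)))" by (simp add: zero_ereal_def)
    also have "\<dots> \<le> liminf (\<lambda>k. ereal (l k) * f (X k))"
    proof (intro Liminf_mono always_eventually allI)
      fix k
      show "ereal (l k * (a \<bullet> X k + b)) \<le> ereal (l k) * f (X k)"
        using ereal_mult_left_mono[OF ab[of "X k"], of "ereal (l k)"] pos[of k] by simp
    qed
    finally show ?thesis using True by (simp add: indicator_fun_def)
  next
    case False
    have "\<forall>\<^sub>F k in sequentially. X k \<in> - closure (effective_domain f)"
      using X False by (intro topological_tendstoD) auto
    then have "\<forall>\<^sub>F k in sequentially. \<infinity> \<le> ereal (l k) * f (X k)"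
    proof eventually_elim
      case (elim k)
      then have "X k \<notin> effective_domain f" using closure_subset by blast
      then have "f (X k) = \<infinity>" by (simp add: effective_domain_def)
      then show ?case using pos[of k] by simp
    qed
    then have "\<infinity> \<le> liminf (\<lambda>k. ereal (l k) * f (X k))" by (rule Liminf_bounded)
    then show ?thesis by simp
  qed
next
  fix l and x :: 'a assume l: "down_to_zero l"
  have pos: "0 < l k" and l0: "l \<longlonglongrightarrow> 0" for k using l by (auto simp: down_to_zero_def)
  show "\<exists>X. X \<longlonglongrightarrow> x \<and> limsup (\<lambda>k. ereal (l k) * f (X k))
      \<le> indicator_fun (closure (effective_domain f)) x"
  proof (cases "x \<in> closure (effective_domain f)")
    case True
    define X where "X = (\<lambda>k. prox (l k) f x)"
    define E where "E = (\<lambda>k. l k * real_of_ereal (moreau_envelope (l k) f x))"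
    have "X \<longlonglongrightarrow> x"
      using prox_tendsto_closest_point[OF f tendsto_const l0, of x] pos closest_point_self[OF True]
      by (simp add: X_def)
    moreover have "limsup (\<lambda>k. ereal (l k) * f (X k)) \<le> limsup (\<lambda>k. ereal (E k))"
    proof (intro Limsup_mono always_eventually allI)
      fix k
      obtain r where r: "f (X k) = ereal r"
        "moreau_envelope (l k) f x = ereal (r + 1 / (2 * l k) * (norm (x - X k))\<^sup>2)"
        unfolding X_def using moreau_envelope_prox[OF f pos] by blast
      show "ereal (l k) * f (X k) \<le> ereal (E k)"
        using pos[of k] by (simp add: r E_def algebra_simps)
    qed
    moreover have "limsup (\<lambda>k. ereal (E k)) = 0"
    proof -
      have "E \<longlonglongrightarrow> 0"
        unfolding E_def using scaled_envelope_tendsto[OF f tendsto_const l0, of x] pos True by simp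
      then have "(\<lambda>k. ereal (E k)) \<longlonglongrightarrow> ereal 0" by (intro tendsto_intros)
      from lim_imp_Limsup[OF sequentially_bot this] show ?thesis by (simp add: zero_ereal_def)
    qed
    ultimately show ?thesis using True by (auto simp: indicator_fun_def)
  next
    case False
    then show ?thesis by (intro exI[of _ "\<lambda>_. x"]) (simp add: indicator_fun_def)
  qed
qed

lemma inner_limit_subset_outer_limit: "inner_limit C \<subseteq> outer_limit C"
proof
  fix z assume "z \<in> inner_limit C"
  then obtain Z N where Z: "Z \<longlonglongrightarrow> z" "\<And>k. N \<le> k \<Longrightarrow> Z k \<in> C k"
    by (auto simp: inner_limit_def eventually_sequentially)
  have "strict_mono (\<lambda>k. k + N)" by (simp add: strict_mono_def)
  moreover have "(\<lambda>k. Z (k + N)) \<longlonglongrightarrow> z" using Z(1) by (rule LIMSEQ_ignore_initial_segment)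
  ultimately show "z \<in> outer_limit C"
    unfolding outer_limit_def using Z(2)
    by (intro CollectI exI[of _ "\<lambda>k. k + N"] exI[of _ "\<lambda>k. Z (k + N)"]) auto
qed

text \<open>By Minty's parametrization, the graph of \<open>l\<close> times the subdifferential consists of the pairs
  \<open>(prox z, z - prox z)\<close> and that of the normal cone map of the pairs \<open>(\<Pi>z, z - \<Pi>z)\<close>, so graphical
  convergence reduces to the convergence of the proximal points to the projection.\<close>

lemma scaled_subdifferential_graph_converges:
  fixes f :: "'a::euclidean_space \<Rightarrow> ereal"
  assumes f: "closed_proper_convex f"
  shows "family_graph_converges (\<lambda>l x. (\<lambda>g. l *\<^sub>R g) ` subdifferential f x)
    (normal_cone (closure (effective_domain f)))"
  unfolding family_graph_converges_def
proof (intro allI impI)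
  fix l assume l: "down_to_zero l"
  have pos: "0 < l k" and l0: "l \<longlonglongrightarrow> 0" for k using l by (auto simp: down_to_zero_def)
  define C where "C = closure (effective_domain f)"
  have C: "closed C" "convex C" "C \<noteq> {}"
    using closed_proper_convex_nonempty_domain[OF f] convex_effective_domain[OF f]
    by (auto simp: C_def convex_closure)
  define G where "G = (\<lambda>k. svm_graph (\<lambda>x. (\<lambda>g. l k *\<^sub>R g) ` subdifferential f x))"
  have G: "(x, v) \<in> G k \<longleftrightarrow> prox (l k) f (x + v) = x" for x v k
    unfolding G_def using scaled_subdifferential_graph_iff[OF f pos] .
  have N: "(x, v) \<in> svm_graph (normal_cone C) \<longleftrightarrow> closest_point C (x + v) = x" for x v
    using normal_cone_closest_point[OF C] by (simp add: svm_graph_def)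
  have outer: "outer_limit G \<subseteq> svm_graph (normal_cone C)"
  proof
    fix z assume "z \<in> outer_limit G"
    then obtain r Z where r: "strict_mono r" and Z: "\<And>k. Z k \<in> G (r k)" "Z \<longlonglongrightarrow> z"
      by (auto simp: outer_limit_def)
    have fst: "(\<lambda>k. fst (Z k)) \<longlonglongrightarrow> fst z" and sum: "(\<lambda>k. fst (Z k) + snd (Z k)) \<longlonglongrightarrow> fst z + snd z"
      using Z(2) by (auto intro!: tendsto_intros)
    have "(\<lambda>k. prox (l (r k)) f (fst (Z k) + snd (Z k))) \<longlonglongrightarrow> closest_point C (fst z + snd z)"
      unfolding C_def
      using LIMSEQ_subseq_LIMSEQ[OF l0 r] pos
      by (intro prox_tendsto_closest_point[OF f sum]) (auto simp: o_def)
    moreover have "prox (l (r k)) f (fst (Z k) + snd (Z k)) = fst (Z k)" for k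
      using Z(1)[of k] G by (metis prod.collapse)
    ultimately have "closest_point C (fst z + snd z) = fst z"
      using fst LIMSEQ_unique by simp
    then show "z \<in> svm_graph (normal_cone C)" using N by (metis prod.collapse)
  qed
  have inner: "svm_graph (normal_cone C) \<subseteq> inner_limit G"
  proof
    fix z assume z: "z \<in> svm_graph (normal_cone C)"
    obtain x v where xv: "z = (x, v)" by force
    define P where "P = (\<lambda>k. prox (l k) f (x + v))"
    have "P \<longlonglongrightarrow> closest_point C (x + v)"
      unfolding P_def C_def using pos by (intro prox_tendsto_closest_point[OF f _ l0]) auto
    then have "P \<longlonglongrightarrow> x" using z N xv by simp
    then have "(\<lambda>k. (P k, x + v - P k)) \<longlonglongrightarrow> (x, x + v - x)" by (intro tendsto_intros)
    moreover have "(P k, x + v - P k) \<in> G k" for k unfolding G by (simp add: P_def)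
    ultimately show "z \<in> inner_limit G"
      unfolding inner_limit_def xv by (auto intro!: exI[of _ "\<lambda>k. (P k, x + v - P k)"])
  qed
  have "PK_converges G (svm_graph (normal_cone C))"
    unfolding PK_converges_def using outer inner inner_limit_subset_outer_limit[of G] by blast
  then show "PK_converges (\<lambda>k. svm_graph (\<lambda>x. (\<lambda>g. l k *\<^sub>R g) ` subdifferential f x))
      (svm_graph (normal_cone (closure (effective_domain f))))"
    by (simp add: G_def C_def)
qed

section \<open>Convergence of the gradients\<close>

lemma tendsto_of_unique_cluster_point:
  fixes V :: "nat \<Rightarrow> 'a::metric_space"
  assumes K: "compact K" "\<And>k. V k \<in> K"
    and uniq: "\<And>r v. strict_mono (r :: nat \<Rightarrow> nat) \<Longrightarrow> (V \<circ> r) \<longlonglongrightarrow> v \<Longrightarrow> v = c"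
  shows "V \<longlonglongrightarrow> c"
proof (rule ccontr)
  assume "\<not> V \<longlonglongrightarrow> c"
  then obtain e where e: "e > 0" "\<not> (\<forall>\<^sub>F k in sequentially. dist (V k) c < e)"
    unfolding tendsto_iff by blast
  define S where "S = {k. \<not> dist (V k) c < e}"
  have "infinite S"
    using e(2) unfolding cofinite_eq_sequentially[symmetric] eventually_cofinite S_def .
  then have en: "strict_mono (enumerate S)" "\<And>k. enumerate S k \<in> S"
    by (simp_all add: strict_mono_enumerate enumerate_in_set)
  have "\<forall>n. (V \<circ> enumerate S) n \<in> K" using K(2) by simp
  then obtain v r where r: "strict_mono r" "((V \<circ> enumerate S) \<circ> r) \<longlonglongrightarrow> v"
    using K(1) unfolding compact_def by blast
  have "v = c"
    using uniq[OF strict_mono_o[OF en(1) r(1)]] r(2) by (simp add: o_assoc)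
  then have "\<forall>\<^sub>F k in sequentially. dist (((V \<circ> enumerate S) \<circ> r) k) c < e"
    using r(2) e(1) by (simp add: tendsto_iff)
  then obtain k where "dist (V (enumerate S (r k))) c < e"
    by (auto simp: eventually_sequentially)
  then show False using en(2)[of "r k"] by (simp add: S_def)
qed

lemma min_norm_unique:
  fixes S :: "'a::euclidean_space set"
  assumes S: "closed S" "convex S" "S \<noteq> {}"
  shows "{g. is_arg_min norm (\<lambda>g. g \<in> S) g} = {closest_point S 0}"
proof (intro equalityI subsetI)
  fix g assume "g \<in> {g. is_arg_min norm (\<lambda>g. g \<in> S) g}"
  then have "g = closest_point S 0"
    by (intro closest_point_unique S) (auto simp: is_arg_min_def not_less)
  then show "g \<in> {closest_point S 0}" by simp
next
  fix g assume "g \<in> {closest_point S 0}"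
  then show "g \<in> {g. is_arg_min norm (\<lambda>g. g \<in> S) g}"
    using closest_point_in_set[OF S(1,3), of 0] closest_point_le[OF S(1), of _ 0]
    by (auto simp: is_arg_min_def not_less)
qed

lemma norm_prox_residual_le:
  fixes f :: "'a::euclidean_space \<Rightarrow> ereal"
  assumes f: "closed_proper_convex f" and l: "0 < l" and g: "g \<in> subdifferential f x"
  shows "norm ((x - prox l f x) /\<^sub>R l) \<le> norm g"
proof -
  define v where "v = (x - prox l f x) /\<^sub>R l"
  have "x - prox l f x = l *\<^sub>R v" using l by (simp add: v_def)
  then have "0 \<le> (g - v) \<bullet> (l *\<^sub>R v)"
    using subdifferential_mono[OF f g prox_subgradient[OF f l, of x]] by (simp add: v_def)
  then have "v \<bullet> v \<le> g \<bullet> v"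
    using l by (simp add: zero_le_mult_iff inner_diff_left)
  also have "\<dots> \<le> norm g * norm v" by (rule norm_cauchy_schwarz)
  finally have "norm v * norm v \<le> norm g * norm v"
    by (simp add: power2_norm_eq_inner[symmetric] power2_eq_square)
  then have "norm v \<le> norm g"
    by (cases "v = 0") (auto simp: mult_le_cancel_right)
  then show ?thesis by (simp add: v_def)
qed

lemma gradient_moreau_envelope_tendsto:
  fixes f :: "'a::euclidean_space \<Rightarrow> ereal"
  assumes f: "closed_proper_convex f" and ne: "subdifferential f x \<noteq> {}"
  shows "((\<lambda>l. gradient (moreau_envelope l f) x)
    \<longlongrightarrow> closest_point (subdifferential f x) 0) (at_right 0)"
  unfolding tendsto_at_iff_sequentially
proof (intro allI impI)
  fix l :: "nat \<Rightarrow> real" assume l: "\<forall>i. l i \<in> {0<..} - {0}" and l0: "l \<longlonglongrightarrow> 0"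
  have pos: "0 < l k" for k using l by auto
  define S where "S = subdifferential f x"
  define g0 where "g0 = closest_point S 0"
  define V where "V = (\<lambda>k. (x - prox (l k) f x) /\<^sub>R l k)"
  obtain r where "f x = ereal r"
    using ne subdifferential_finite[OF f] effective_domain_realE[OF f] by blast
  then have S: "closed S" "convex S" "S \<noteq> {}"
    using subdifferential_closed_convex[OF f] ne by (auto simp: S_def)
  have g0: "g0 \<in> S" unfolding g0_def using S by (intro closest_point_in_set)
  have bound: "norm (V k) \<le> norm g0" for k
    unfolding V_def using norm_prox_residual_le[OF f pos] g0 by (simp add: S_def)
  have "(\<lambda>k. l k *\<^sub>R V k) \<longlonglongrightarrow> 0"
  proof (rule Lim_null_comparison)
    show "\<forall>\<^sub>F k in sequentially. norm (l k *\<^sub>R V k) \<le> l k * norm g0"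
      using pos bound by (intro always_eventually allI) (simp add: abs_of_pos)
    have "(\<lambda>k. l k * norm g0) \<longlonglongrightarrow> 0 * norm g0" by (intro tendsto_intros l0)
    then show "(\<lambda>k. l k * norm g0) \<longlonglongrightarrow> 0" by simp
  qed
  then have "(\<lambda>k. x - l k *\<^sub>R V k) \<longlonglongrightarrow> x - 0" by (intro tendsto_intros)
  moreover have "x - l k *\<^sub>R V k = prox (l k) f x" for k
    using pos[of k] by (simp add: V_def)
  ultimately have P: "(\<lambda>k. prox (l k) f x) \<longlonglongrightarrow> x" by simp
  have "V \<longlonglongrightarrow> g0"
  proof (rule tendsto_of_unique_cluster_point)
    show "compact (cball (0::'a) (norm g0))" by (rule compact_cball)
    show "V k \<in> cball (0::'a) (norm g0)" for k using bound by simp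
    fix r v assume r: "strict_mono (r :: nat \<Rightarrow> nat)" and v: "(V \<circ> r) \<longlonglongrightarrow> v"
    have "v \<in> S"
      unfolding S_def
    proof (rule subdifferential_closed_graph[OF f _ v])
      show "(\<lambda>k. prox (l (r k)) f x) \<longlonglongrightarrow> x"
        using LIMSEQ_subseq_LIMSEQ[OF P r] by (simp add: o_def)
      show "(V \<circ> r) k \<in> subdifferential f (prox (l (r k)) f x)" for k
        using prox_subgradient[OF f pos] by (simp add: V_def)
    qed
    moreover have "norm v \<le> norm g0"
      using tendsto_norm[OF v] bound by (intro LIMSEQ_le_const2[of _ _ "norm g0"]) auto
    ultimately show "v = g0"
      using closest_point_lt[OF S(2,1), of v 0] by (force simp: g0_def)
  qed
  moreover have "gradient (moreau_envelope (l k) f) x = V k" for k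
    unfolding V_def by (intro gradient_eq has_gradient_moreau_envelope f pos)
  ultimately show "((\<lambda>l. gradient (moreau_envelope l f) x) \<circ> l)
      \<longlonglongrightarrow> closest_point (subdifferential f x) 0"
    by (simp add: o_def g0_def S_def)
qed

section \<open>Limits as the parameter tends to zero\<close>

theorem proposition4:
  fixes f :: "'a::euclidean_space \<Rightarrow> ereal"
  assumes "closed_proper_convex f"
  shows
    "(family_epi_converges (\<lambda>l. moreau_envelope l f) f
      \<and> family_pointwise_converges (\<lambda>l. moreau_envelope l f) f
      \<and> (\<forall>x. antimono_on {0<..} (\<lambda>l. moreau_envelope l f x)
           \<and> ((\<lambda>l. moreau_envelope l f x) \<longlongrightarrow> f x) (at_right 0)))
     \<and> family_epi_converges (\<lambda>l x. ereal l * f x)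
         (indicator_fun (closure (effective_domain f)))
     \<and> (\<forall>xbar. ((\<lambda>(x, l). ereal l * moreau_envelope l f x)
           \<longlongrightarrow> ereal (1 / 2 * (infdist xbar (closure (effective_domain f)))\<^sup>2))
           (nhds xbar \<times>\<^sub>F at_right 0))
     \<and> family_graph_converges (\<lambda>l x. (\<lambda>g. l *\<^sub>R g) ` subdifferential f x)
         (normal_cone (closure (effective_domain f)))
     \<and> (\<forall>x \<in> svm_domain (subdifferential f).
          (\<forall>l>0. has_gradient (moreau_envelope l f) x (gradient (moreau_envelope l f) x))
          \<and> (\<exists>g0. {g. is_arg_min norm (\<lambda>g. g \<in> subdifferential f x) g} = {g0}
               \<and> ((\<lambda>l. gradient (moreau_envelope l f) x) \<longlongrightarrow> g0) (at_right 0)))"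
proof -
  note f = assms
  have epi: "family_epi_converges (\<lambda>l. moreau_envelope l f) f"
    by (rule moreau_envelope_epi_converges[OF f])
  have pointwise: "family_pointwise_converges (\<lambda>l. moreau_envelope l f) f"
    unfolding family_pointwise_converges_def
    by (auto simp: down_to_zero_def intro!: moreau_envelope_tendsto f)
  have increasing: "antimono_on {0<..} (\<lambda>l. moreau_envelope l f x)
      \<and> ((\<lambda>l. moreau_envelope l f x) \<longlongrightarrow> f x) (at_right 0)" for x
    by (intro conjI moreau_envelope_antimono moreau_envelope_tendsto f tendsto_ident_at
        eventually_at_right_less)
  have scaled: "((\<lambda>(x, l). ereal l * moreau_envelope l f x)
      \<longlongrightarrow> ereal (1 / 2 * (infdist xbar (closure (effective_domain f)))\<^sup>2))
      (nhds xbar \<times>\<^sub>F at_right 0)" for xbar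
  proof -
    have snd: "filterlim snd (at_right (0::real)) (nhds xbar \<times>\<^sub>F at_right 0)"
      by (rule filterlim_snd)
    have pos: "\<forall>\<^sub>F z in nhds xbar \<times>\<^sub>F at_right (0::real). 0 < snd z"
      using snd eventually_at_right_less[of "0::real"] by (auto simp: filterlim_iff)
    have "((\<lambda>z. ereal (snd z * real_of_ereal (moreau_envelope (snd z) f (fst z))))
        \<longlongrightarrow> ereal (1 / 2 * (infdist xbar (closure (effective_domain f)))\<^sup>2))
        (nhds xbar \<times>\<^sub>F at_right 0)"
      by (intro tendsto_ereal scaled_envelope_tendsto f pos filterlim_fst
          filterlim_mono[OF snd at_within_le_nhds order_refl])
    moreover have "\<forall>\<^sub>F z in nhds xbar \<times>\<^sub>F at_right (0::real).
        ereal (snd z * real_of_ereal (moreau_envelope (snd z) f (fst z)))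
        = (case z of (x, l) \<Rightarrow> ereal l * moreau_envelope l f x)"
      using pos
    proof eventually_elim
      case (elim z)
      obtain e where "moreau_envelope (snd z) f (fst z) = ereal e"
        using moreau_envelope_prox[OF f elim] by blast
      then show ?case by (simp add: case_prod_beta)
    qed
    ultimately show ?thesis by (rule Lim_transform_eventually)
  qed
  have gradients: "(\<forall>l>0. has_gradient (moreau_envelope l f) x (gradient (moreau_envelope l f) x))
      \<and> (\<exists>g0. {g. is_arg_min norm (\<lambda>g. g \<in> subdifferential f x) g} = {g0}
           \<and> ((\<lambda>l. gradient (moreau_envelope l f) x) \<longlongrightarrow> g0) (at_right 0))"
    if x: "x \<in> svm_domain (subdifferential f)" for x
  proof -
    have ne: "subdifferential f x \<noteq> {}" using x by (simp add: svm_domain_def)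
    then obtain r where "f x = ereal r"
      using subdifferential_finite[OF f] effective_domain_realE[OF f] by blast
    then have "{g. is_arg_min norm (\<lambda>g. g \<in> subdifferential f x) g}
        = {closest_point (subdifferential f x) 0}"
      using subdifferential_closed_convex[OF f] ne by (intro min_norm_unique)
    moreover have "has_gradient (moreau_envelope l f) x (gradient (moreau_envelope l f) x)"
      if "0 < l" for l
      using has_gradient_moreau_envelope[OF f that, of x] gradient_eq by metis
    ultimately show ?thesis using gradient_moreau_envelope_tendsto[OF f ne] by blast
  qed
  show ?thesis
    using epi pointwise increasing scaled_epi_converges[OF f] scaled
      scaled_subdifferential_graph_converges[OF f] gradients
    by blast
qed

end
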